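(* Work over the max-plus semifield $\mathbb{R}_{\max,+}=(\mathbb{R}\cup\{-\infty\},\oplus,\otimes)$. Let $A,B,C$ be $n\times n$ matrices with entries in $\mathbb{R}\cup\{-\infty\}$ and let $d$ be a vector of order $n$. Consider the problem of finding regular vectors $x$ and vectors $y$ of order $n$ that $$\text{minimize } d^{-}y\oplus y^{-}d\quad\text{subject to}\quad Ax=y,\quad Bx\leq x,\quad Cy\leq x .$$ Suppose that $A$ is a row-regular matrix, that the matrix $D=B\oplus CA$ satisfies the condition $\mathrm{Tr}(D)\leq\mathbb{1}$, and that $d$ is a regular vector. Then the minimum value of the problem is equal to $$\Delta=\bigl((AD^{\ast}(d^{-}AD^{\ast})^{-})^{-}d\bigr)^{1/2},$$ and the maximum solution is given by $$x=\Delta D^{\ast}(d^{-}AD^{\ast})^{-},\qquad y=\Delta AD^{\ast}(d^{-}AD^{\ast})^{-}.$$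
   Context: Max-plus semifield: on $\mathbb{X}=\mathbb{R}\cup\{-\infty\}$ put $a\oplus b=\max(a,b)$ and $a\otimes b=a+b$ (the sign $\otimes$ is omitted), with zero $\mathbb{0}=-\infty$ and identity $\mathbb{1}=0$ (the real number zero). For $a\in\mathbb{R}$, $a^{-1}=-a$, and for a rational exponent $p$ the power $a^{p}$ is the ordinary product $pa$. The order is the usual order on $\mathbb{R}\cup\{-\infty\}$, and it extends entrywise to vectors and matrices. Matrix addition, matrix multiplication and scalar multiplication follow the standard rules with $\oplus,\otimes$ in place of $+,\times$. $I$ is the identity matrix ($\mathbb{1}$ on the diagonal, $\mathbb{0}$ elsewhere); $D^{0}=I$, $D^{p}=D^{p-1}D$. Vectors are column vectors unless stated otherwise. A matrix is row-regular if no row consists entirely of $\mathbb{0}$. A vector is regular if none of its entries is $\mathbb{0}$. Multiplicative conjugate transpose: for an $m\times n$ matrix $M=(m_{ij})$, $M^{-}$ is the $n\times m$ matrix with entries $(M^{-})_{ij}=m_{ji}^{-1}$ if $m_{ji}\neq\mathbb{0}$ and $\mathbb{0}$ otherwise. In particular it turns column vectors into row vectors and row vectors into column vectors. For an $n\times n$ matrix $D=(d_{ij})$: $\mathrm{tr}\,D=\bigoplus_{i=1}^{n}d_{ii}$, $\mathrm{Tr}(D)=\bigoplus_{k=1}^{n}\mathrm{tr}(D^{k})$, and, when $\mathrm{Tr}(D)\leq\mathbb{1}$, $D^{\ast}=\bigoplus_{k=0}^{n-1}D^{k}$. A solution is a feasible pair $(x,y)$ attaining the minimum; the maximum solution is the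 solution that is entrywise greatest among all solutions.
   Formalization: The displayed pair is claimed to be the maximum solution only when the row vector d⁻AD* is regular; otherwise no maximum solution exists (the displayed x may even be non-regular). The minimum value Δ is proved under the original hypotheses. *)

theory Defs
  imports "HOL-Analysis.Analysis"
begin

text \<open>The max-plus semifield is made an instance of \<^class>\<open>comm_semiring_1\<close>, so that
  \<open>0\<close> is minus infinity, \<open>1\<close> is the real number zero, \<open>+\<close> is the maximum and
  \<open>*\<close> is ordinary addition, and the matrix operations of the library
  (\<open>**\<close>, \<open>*v\<close>, \<open>v*\<close>, \<open>*s\<close>, \<open>mat 1\<close>, \<^const>\<open>trace\<close>, finite sums) are the max-plus ones.\<close>

datatype maxplus = NegInf | Fin real

instantiation maxplus :: linorder
begin

fun less_eq_maxplus :: "maxplus \<Rightarrow> maxplus \<Rightarrow> bool" where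
  "NegInf \<le> b \<longleftrightarrow> True"
| "Fin a \<le> NegInf \<longleftrightarrow> False"
| "Fin a \<le> Fin b \<longleftrightarrow> a \<le> b"

definition less_maxplus :: "maxplus \<Rightarrow> maxplus \<Rightarrow> bool" where
  "a < b \<longleftrightarrow> a \<le> b \<and> \<not> b \<le> (a::maxplus)"

instance
proof
  fix x y z :: maxplus
  show "x < y \<longleftrightarrow> x \<le> y \<and> \<not> y \<le> x" by (rule less_maxplus_def)
  show "x \<le> x" by (cases x) auto
  show "x \<le> y \<Longrightarrow> y \<le> z \<Longrightarrow> x \<le> z" by (cases x; cases y; cases z) auto
  show "x \<le> y \<Longrightarrow> y \<le> x \<Longrightarrow> x = y" by (cases x; cases y) auto
  show "x \<le> y \<or> y \<le> x" by (cases x; cases y) auto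
qed

end

instantiation maxplus :: comm_semiring_1
begin

definition zero_maxplus :: maxplus where "(0::maxplus) = NegInf"

definition one_maxplus :: maxplus where "1 = Fin 0"

definition plus_maxplus :: "maxplus \<Rightarrow> maxplus \<Rightarrow> maxplus" where "a + b = max a (b::maxplus)"

fun times_maxplus :: "maxplus \<Rightarrow> maxplus \<Rightarrow> maxplus" where
  "Fin a * Fin b = Fin (a + b)"
| "NegInf * b = NegInf"
| "Fin a * NegInf = NegInf"

instance
proof
  fix a b c :: maxplus
  show "a + b + c = a + (b + c)" by (simp add: plus_maxplus_def max.assoc)
  show "a + b = b + a" by (simp add: plus_maxplus_def max.commute)
  show "0 + a = a" by (simp add: plus_maxplus_def zero_maxplus_def max_def)
  show "a * b * c = a * (b * c)" by (cases a; cases b; cases c) auto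
  show "a * b = b * a" by (cases a; cases b) auto
  show "1 * a = a" by (cases a) (auto simp: one_maxplus_def)
  show "(a + b) * c = a * c + b * c"
    by (cases a; cases b; cases c) (auto simp: plus_maxplus_def max_def)
  show "0 * a = 0" by (simp add: zero_maxplus_def)
  show "a * 0 = 0" by (cases a) (auto simp: zero_maxplus_def)
  show "(0::maxplus) \<noteq> 1" by (simp add: zero_maxplus_def one_maxplus_def)
qed

end

text \<open>Inverse and rational powers are meant for finite arguments; the value at \<open>NegInf\<close> is a dummy.\<close>

fun mp_inverse :: "maxplus \<Rightarrow> maxplus" where
  "mp_inverse (Fin a) = Fin (- a)"
| "mp_inverse NegInf = NegInf"

fun mp_pow :: "maxplus \<Rightarrow> rat \<Rightarrow> maxplus" where
  "mp_pow (Fin a) p = Fin (of_rat p * a)"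
| "mp_pow NegInf p = NegInf"

definition row_regular :: "maxplus^'n^'m \<Rightarrow> bool" where
  "row_regular M \<longleftrightarrow> (\<forall>i. \<exists>j. M $ i $ j \<noteq> 0)"

definition regular_vec :: "maxplus^'n \<Rightarrow> bool" where
  "regular_vec v \<longleftrightarrow> (\<forall>i. v $ i \<noteq> 0)"

text \<open>Multiplicative conjugate transpose of a vector. Rows and columns share the type
  \<open>maxplus^'n\<close>: a row times a matrix is written with \<open>v*\<close>, a matrix times a column with \<open>*v\<close>,
  and a row times a column with \<^const>\<open>scalar_product\<close>.\<close>

definition conj_tr :: "maxplus^'n \<Rightarrow> maxplus^'n" where
  "conj_tr v = (\<chi> i. if v $ i \<noteq> 0 then mp_inverse (v $ i) else 0)"

text \<open>The power operation \<open>^\<close> of the library is componentwise on vectors and matrices,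
  hence a separate matrix power.\<close>

primrec mat_pow :: "maxplus^'n^'n \<Rightarrow> nat \<Rightarrow> maxplus^'n^'n" where
  "mat_pow D 0 = mat 1"
| "mat_pow D (Suc k) = mat_pow D k ** D"

definition Tr :: "maxplus^'n^'n \<Rightarrow> maxplus" where
  "Tr D = (\<Sum>k = 1..CARD('n). trace (mat_pow D k))"

definition star :: "maxplus^'n^'n \<Rightarrow> maxplus^'n^'n" where
  "star D = (\<Sum>k = 0..<CARD('n). mat_pow D k)"

definition objective :: "maxplus^'n \<Rightarrow> maxplus^'n \<Rightarrow> maxplus" where
  "objective d y = scalar_product (conj_tr d) y + scalar_product (conj_tr y) d"

definition feasible ::
  "maxplus^'n^'n \<Rightarrow> maxplus^'n^'n \<Rightarrow> maxplus^'n^'n \<Rightarrow> maxplus^'n \<Rightarrow> maxplus^'n \<Rightarrow> bool" where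
  "feasible A B C x y \<longleftrightarrow> regular_vec x \<and> A *v x = y \<and> B *v x \<le> x \<and> C *v y \<le> x"

definition solution ::
  "maxplus^'n^'n \<Rightarrow> maxplus^'n^'n \<Rightarrow> maxplus^'n^'n \<Rightarrow> maxplus^'n
    \<Rightarrow> maxplus^'n \<Rightarrow> maxplus^'n \<Rightarrow> bool" where
  "solution A B C d x y \<longleftrightarrow>
    is_arg_min (\<lambda>(x, y). objective d y) (\<lambda>(x, y). feasible A B C x y) (x, y)"

definition minimum_value ::
  "maxplus^'n^'n \<Rightarrow> maxplus^'n^'n \<Rightarrow> maxplus^'n^'n \<Rightarrow> maxplus^'n \<Rightarrow> maxplus \<Rightarrow> bool" where
  "minimum_value A B C d m \<longleftrightarrow> (\<exists>x y. solution A B C d x y \<and> objective d y = m)"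

text \<open>A maximum solution need not exist: if \<open>A\<close> and \<open>D = B + C ** A\<close> are such that column \<open>j\<close>
  of \<open>A ** star D\<close> is zero, then \<open>x $ j\<close> can be increased indefinitely without changing \<open>y\<close>.\<close>

definition maximum_solution ::
  "maxplus^'n^'n \<Rightarrow> maxplus^'n^'n \<Rightarrow> maxplus^'n^'n \<Rightarrow> maxplus^'n
    \<Rightarrow> maxplus^'n \<Rightarrow> maxplus^'n \<Rightarrow> bool" where
  "maximum_solution A B C d x y \<longleftrightarrow>
    solution A B C d x y \<and> (\<forall>x' y'. solution A B C d x' y' \<longrightarrow> x' \<le> x \<and> y' \<le> y)"

end

theory Submission
  imports Defs
begin

text \<open>
  Eliminating \<open>y = A *v x\<close> turns the constraints into the single inequality \<open>D *v x \<le> x\<close>. Its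
  solutions are exactly the vectors fixed by \<open>star D\<close> (\<open>star_vec_eq\<close>, \<open>matrix_star_vec_le\<close>). The
  combinatorial ingredient is that the star may stop at the power \<open>n - 1\<close>, where \<open>n\<close> is the
  dimension: a walk of \<open>n\<close> steps in the weighted digraph of \<open>D\<close> contains a cycle, and \<open>Tr D \<le> 1\<close> makes cutting it out harmless
  (\<open>mat_pow_card_le_star\<close>). For feasible pairs therefore \<open>y = P *v x\<close> with \<open>P = A ** star D\<close>.

  The first term of the objective is at most \<open>t\<close> iff \<open>r $ j * x $ j \<le> t\<close> for all \<open>j\<close>, where \<open>r\<close> is
  the row \<open>conj_tr d v* P\<close>. Where \<open>r $ j\<close> is finite this bounds \<open>x $ j\<close> by \<open>t * u $ j\<close> with
  \<open>u = conj_tr r\<close>; where it is not, column \<open>j\<close> of \<open>P\<close> is zero. In either case \<open>y \<le> t *s (P *v u)\<close>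
  (\<open>image_le_col_bound_image\<close>). The second term of the objective is antitone in \<open>y\<close>, so it is at
  least \<open>scalar_product (conj_tr (P *v u)) d\<close> divided by \<open>t\<close>. Since it is also at most \<open>t\<close>, the
  square of \<open>t\<close> is bounded below, which is the lower bound \<open>\<Delta>\<close> (\<open>optimum_le_objective\<close>). The
  bound is attained at \<open>y = \<Delta> *s (P *v u)\<close> (\<open>objective_col_bound_image_le\<close>), which comes from a
  feasible \<open>x\<close> once the entries of \<open>u\<close> at zero columns of \<open>P\<close> are replaced by any finite values
  (\<open>star_scaled_solution\<close>).

  If \<open>r\<close> is regular, every solution obeys \<open>x \<le> \<Delta> *s u\<close> and \<open>x\<close> is fixed by \<open>star D\<close>, so
  \<open>x \<le> \<Delta> *s (star D *v u)\<close>, and this bound is itself a solution. If some \<open>r $ j\<close> is zero, the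
  replacement value at \<open>j\<close> can be raised without limit, so there is no maximum solution and the uniqueness
  claim is vacuous.
\<close>

section \<open>The order and the multiplication of the max-plus semifield\<close>

text \<open>Since addition is the maximum, the order is the one induced by addition. Dioids supply
  that \<open>0\<close> is the least element and that sums and products are monotone.\<close>

instance maxplus :: dioid
proof
  fix a b :: maxplus
  show "a \<le> b \<longleftrightarrow> (\<exists>c. b = a + c)"
    by (metis max.absorb2 max.cobounded1 plus_maxplus_def)
qed

instance maxplus :: semiring_no_zero_divisors
proof
  fix a b :: maxplus
  show "a \<noteq> 0 \<Longrightarrow> b \<noteq> 0 \<Longrightarrow> a * b \<noteq> 0"
    by (cases a; cases b) (auto simp: zero_maxplus_def)
qed

lemma maxplus_add_le_iff: "a + b \<le> c \<longleftrightarrow> a \<le> c \<and> b \<le> c" for a b c :: maxplus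
  by (simp add: plus_maxplus_def)

lemma maxplus_sum_le_iff:
  fixes f :: "'b \<Rightarrow> maxplus"
  assumes "finite S"
  shows "sum f S \<le> t \<longleftrightarrow> (\<forall>i\<in>S. f i \<le> t)"
  using assms by (induction S rule: finite_induct) (auto simp: maxplus_add_le_iff)

lemma maxplus_sum_attained:
  fixes f :: "'b \<Rightarrow> maxplus"
  assumes "finite S" and "S \<noteq> {}"
  shows "\<exists>i\<in>S. sum f S = f i"
  using assms
  by (induction S rule: finite_ne_induct) (auto simp: plus_maxplus_def max_def)

lemma mp_inverse_0 [simp]: "mp_inverse 0 = 0"
  by (simp add: zero_maxplus_def)

lemma mp_inverse_eq_0_iff [simp]: "mp_inverse a = 0 \<longleftrightarrow> a = 0"
  by (cases a) (auto simp: zero_maxplus_def)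

lemma mp_inverse_mult: "mp_inverse (a * b) = mp_inverse a * mp_inverse b"
  by (cases a; cases b) auto

lemma mult_mp_inverse: "a \<noteq> 0 \<Longrightarrow> a * mp_inverse a = 1"
  by (cases a) (auto simp: zero_maxplus_def one_maxplus_def)

lemma mult_mp_inverse_le_1: "a * mp_inverse a \<le> 1"
  by (cases a) (auto simp: one_maxplus_def)

text \<open>A finite coefficient is invertible, so it can be carried across an inequality. For
  \<open>a = 0\<close> the left side is vacuous: this is why columns that vanish have to be treated separately
  below.\<close>

lemma maxplus_residuation:
  assumes "a \<noteq> 0"
  shows "a * x \<le> t \<longleftrightarrow> x \<le> t * mp_inverse a"
  using assms by (cases a; cases x; cases t) (auto simp: zero_maxplus_def)

lemma mp_inverse_antimono:
  assumes "a \<noteq> 0" and "a \<le> b"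
  shows "mp_inverse b \<le> mp_inverse a"
  using assms by (cases a; cases b) (auto simp: zero_maxplus_def)

lemma mp_pow_eq_0_iff: "mp_pow a p = 0 \<longleftrightarrow> a = 0"
  by (cases a) (auto simp: zero_maxplus_def)

lemma mp_sqrt_mult_self: "mp_pow a (1/2) * mp_pow a (1/2) = a"
  by (cases a) (auto simp: of_rat_divide)

lemma mp_sqrt_le: "a \<le> t * t \<Longrightarrow> mp_pow a (1/2) \<le> t"
  by (cases a; cases t) (auto simp: of_rat_divide)


section \<open>Vectors and matrices\<close>

lemma scale_vec_mono: "v \<le> w \<Longrightarrow> c *s v \<le> c *s w" for v w :: "'a::dioid^'n"
  by (simp add: less_eq_vec_def mult_left_mono)

lemma matrix_vector_le_iff:
  fixes M :: "maxplus^'n^'m"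
  shows "M *v x \<le> y \<longleftrightarrow> (\<forall>i j. M $ i $ j * x $ j \<le> y $ i)"
  by (simp add: less_eq_vec_def matrix_vector_mult_def maxplus_sum_le_iff)

lemma matrix_vector_entry_le:
  fixes M :: "'a::dioid^'n^'m"
  shows "M $ i $ j * x $ j \<le> (M *v x) $ i"
  by (simp add: matrix_vector_mult_def member_le_sum[of j UNIV "\<lambda>j. M $ i $ j * x $ j"])

lemma matrix_vector_mono:
  fixes M N :: "'a::dioid^'n^'m"
  assumes "M \<le> N" and "x \<le> y"
  shows "M *v x \<le> N *v y"
  using assms
  by (auto simp: less_eq_vec_def matrix_vector_mult_def intro!: sum_mono mult_mono)

lemma matrix_vector_scale: "M *v (c *s x) = c *s (M *v x)"
  for M :: "'a::comm_semiring_1^'n^'m"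
  by (simp add: vec_eq_iff matrix_vector_mult_def sum_distrib_left mult_ac)

lemma matrix_mult_entry_le:
  fixes M :: "'a::dioid^'n^'m" and N :: "'a^'k^'n"
  shows "M $ i $ l * N $ l $ j \<le> (M ** N) $ i $ j"
  by (simp add: matrix_matrix_mult_def member_le_sum[of l UNIV "\<lambda>l. M $ i $ l * N $ l $ j"])

lemma scalar_product_le_iff:
  fixes v w :: "maxplus^'n"
  shows "scalar_product v w \<le> t \<longleftrightarrow> (\<forall>i. v $ i * w $ i \<le> t)"
  by (simp add: scalar_product_def maxplus_sum_le_iff)

lemma scalar_product_matrix_vector:
  "scalar_product v (M *v x) = scalar_product (v v* M) x"
  for M :: "'a::comm_semiring_1^'n^'m"
  unfolding scalar_product_def matrix_vector_mult_def vector_matrix_mult_def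
  by (simp add: sum_distrib_left sum_distrib_right mult_ac) (rule sum.swap)

lemma scalar_product_scale_left: "scalar_product (c *s v) w = c * scalar_product v w"
  by (simp add: scalar_product_def sum_distrib_left mult_ac)

lemma scalar_product_scale_right: "scalar_product v (c *s w) = c * scalar_product v w"
  for c :: "'a::comm_semiring_1"
  by (simp add: scalar_product_def sum_distrib_left mult_ac)

lemma conj_tr_nth [simp]: "conj_tr v $ i = mp_inverse (v $ i)"
  by (simp add: conj_tr_def)

lemma conj_tr_scale: "conj_tr (c *s v) = mp_inverse c *s conj_tr v"
  by (simp add: vec_eq_iff mp_inverse_mult)

lemma conj_tr_antimono:
  assumes "regular_vec v" and "v \<le> w"
  shows "conj_tr w \<le> conj_tr v"
  using assms by (simp add: less_eq_vec_def regular_vec_def mp_inverse_antimono)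

lemma scalar_product_mono_left:
  fixes v w x :: "'a::dioid^'n"
  shows "v \<le> w \<Longrightarrow> scalar_product v x \<le> scalar_product w x"
  by (auto simp: less_eq_vec_def scalar_product_def intro!: sum_mono mult_right_mono)

text \<open>A sum in a max-plus algebra cannot cancel, so one finite summand keeps the sum finite.\<close>

lemma scalar_product_conj_tr_ne_0:
  assumes "regular_vec v" and "regular_vec w"
  shows "scalar_product (conj_tr v) w \<noteq> 0"
  using assms by (auto simp: scalar_product_def regular_vec_def)

lemma regular_vec_scale: "c \<noteq> 0 \<Longrightarrow> regular_vec v \<Longrightarrow> regular_vec (c *s v)"
  by (simp add: regular_vec_def)

lemma regular_vec_mono:
  assumes "regular_vec v" and "v \<le> w"
  shows "regular_vec w"
  using assms by (metis le_zero_eq regular_vec_def less_eq_vec_def)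

lemma row_regular_mono:
  assumes "row_regular M" and "M \<le> N"
  shows "row_regular N"
  using assms by (metis le_zero_eq row_regular_def less_eq_vec_def)

lemma regular_vec_matrix_vector:
  assumes "row_regular M" and "regular_vec x"
  shows "regular_vec (M *v x)"
  using assms unfolding regular_vec_def row_regular_def
  by (metis le_zero_eq matrix_vector_entry_le mult_eq_0_iff)


section \<open>Powers, walks, and the star of a matrix\<close>

lemma mat_pow_add: "mat_pow M (k + l) = mat_pow M k ** mat_pow M l"
  by (induction l) (simp_all add: matrix_mul_assoc)

text \<open>The entry \<open>(i, j)\<close> of the \<open>k\<close>-th power is the greatest weight of a walk with \<open>k\<close> steps
  from \<open>i\<close> to \<open>j\<close> in the digraph weighted by \<open>M\<close>, where weights multiply (that is, add up in the reals)
  along a walk. A walk is a function from step numbers to vertices. An entry \<open>0\<close> is excluded because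
  there need not be any walk behind it: the zeroth power off the diagonal is an instance.\<close>

lemma mat_pow_attained_by_walk:
  assumes "mat_pow M k $ i $ j \<noteq> 0"
  shows "\<exists>p. p 0 = i \<and> p k = j \<and> mat_pow M k $ i $ j = (\<Prod>t<k. M $ p t $ p (Suc t))"
  using assms
proof (induction k arbitrary: j)
  case 0
  then have "i = j" by (auto simp: mat_def split: if_splits)
  then show ?case by (auto simp: mat_def intro: exI[of _ "\<lambda>_. i"])
next
  case (Suc k)
  obtain l where l: "mat_pow M (Suc k) $ i $ j = mat_pow M k $ i $ l * M $ l $ j"
    using maxplus_sum_attained[of UNIV "\<lambda>l. mat_pow M k $ i $ l * M $ l $ j"]
    by (auto simp: matrix_matrix_mult_def)
  with Suc.prems have "mat_pow M k $ i $ l \<noteq> 0" by auto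
  with Suc.IH obtain p where p: "p 0 = i" "p k = l"
      "mat_pow M k $ i $ l = (\<Prod>t<k. M $ p t $ p (Suc t))" by blast
  let ?q = "p(Suc k := j)"
  have "(\<Prod>t<k. M $ ?q t $ ?q (Suc t)) = (\<Prod>t<k. M $ p t $ p (Suc t))"
    by (rule prod.cong) auto
  with l p show ?case by (intro exI[of _ ?q]) simp
qed

text \<open>The other half of the description by walks, stated for a segment starting at an
  arbitrary time \<open>a\<close> so that it applies to the pieces of a walk that is cut.\<close>

lemma walk_weight_le_mat_pow:
  "(\<Prod>t = a..<a + k. M $ p t $ p (Suc t)) \<le> mat_pow M k $ p a $ p (a + k)"
proof (induction k)
  case 0
  show ?case by (simp add: mat_def)
next
  case (Suc k)
  have "(\<Prod>t = a..<a + Suc k. M $ p t $ p (Suc t))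
      \<le> mat_pow M k $ p a $ p (a + k) * M $ p (a + k) $ p (Suc (a + k))"
    using Suc.IH by (simp add: mult_right_mono)
  also have "\<dots> \<le> mat_pow M (Suc k) $ p a $ p (a + Suc k)"
    using matrix_mult_entry_le by simp
  finally show ?case .
qed

lemma mat_pow_le_star: "k < CARD('n) \<Longrightarrow> mat_pow M k \<le> star M" for M :: "maxplus^'n^'n"
  by (auto simp: less_eq_vec_def star_def sum_component
      intro: member_le_sum[of k "{0..<CARD('n)}" "\<lambda>k. mat_pow M k $ _ $ _"])

lemma mat_pow_diagonal_le_Tr:
  fixes M :: "maxplus^'n^'n"
  assumes "1 \<le> k" and "k \<le> CARD('n)"
  shows "mat_pow M k $ i $ i \<le> Tr M"
proof -
  have "mat_pow M k $ i $ i \<le> trace (mat_pow M k)"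
    unfolding trace_def using member_le_sum[of i UNIV "\<lambda>i. mat_pow M k $ i $ i"] by simp
  also have "\<dots> \<le> Tr M"
    unfolding Tr_def
    using assms member_le_sum[of k "{1..CARD('n)}" "\<lambda>k. trace (mat_pow M k)"] by simp
  finally show ?thesis .
qed

text \<open>The condition on the trace function says that no cycle of length at most the dimension \<open>n\<close> has a weight
  above \<open>1\<close>. A walk with \<open>n\<close> steps visits \<open>n + 1\<close> vertices, so it contains such a cycle; cutting
  the cycle out gives a walk with fewer than \<open>n\<close> steps and at least the same weight. Hence the \<open>n\<close>-th
  power contributes nothing beyond the powers that make up the star.\<close>

lemma mat_pow_card_le_star:
  fixes M :: "maxplus^'n^'n"
  assumes "Tr M \<le> 1"
  shows "mat_pow M CARD('n) \<le> star M"
  unfolding less_eq_vec_def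
proof (intro allI)
  fix i j :: 'n
  let ?n = "CARD('n)"
  show "mat_pow M ?n $ i $ j \<le> star M $ i $ j"
  proof (cases "mat_pow M ?n $ i $ j = 0")
    case True
    then show ?thesis by simp
  next
    case False
    obtain p where p: "p 0 = i" "p ?n = j"
        "mat_pow M ?n $ i $ j = (\<Prod>t<?n. M $ p t $ p (Suc t))"
      using mat_pow_attained_by_walk[OF False] by blast
    have "\<not> inj_on p {0..?n}"
      using card_inj_on_le[of p "{0..?n}" UNIV] by auto
    then obtain a b where ab: "a < b" "b \<le> ?n" "p a = p b"
      by (auto simp: inj_on_def) (metis linorder_neqE_nat)
    let ?w = "\<lambda>s t. \<Prod>r = s..<t. M $ p r $ p (Suc r)"
    have w_le: "?w s t \<le> mat_pow M (t - s) $ p s $ p t" if "s \<le> t" for s t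
      using walk_weight_le_mat_pow[of M p s "t - s"] that by simp
    have "?w a b \<le> mat_pow M (b - a) $ p a $ p a"
      using w_le[of a b] ab by simp
    also have "\<dots> \<le> Tr M"
      using ab by (intro mat_pow_diagonal_le_Tr) auto
    finally have cycle: "?w a b \<le> 1" using assms by simp
    have "mat_pow M ?n $ i $ j = ?w 0 ?n"
      using p by (simp add: lessThan_atLeast0)
    also have "\<dots> = ?w 0 a * ?w a b * ?w b ?n"
      using ab by (simp add: prod.atLeastLessThan_concat)
    also have "\<dots> \<le> ?w 0 a * 1 * ?w b ?n"
      using cycle by (intro mult_mono) auto
    also have "\<dots> \<le> mat_pow M a $ p 0 $ p a * mat_pow M (?n - b) $ p b $ p ?n"
      using w_le[of 0 a] w_le[of b ?n] ab by (auto intro: mult_mono)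
    also have "\<dots> \<le> mat_pow M (a + (?n - b)) $ i $ j"
      unfolding mat_pow_add using ab p matrix_mult_entry_le by metis
    also have "\<dots> \<le> star M $ i $ j"
      using mat_pow_le_star[of "a + (?n - b)" M] ab by (auto simp: less_eq_vec_def)
    finally show ?thesis .
  qed
qed

lemma mat_1_le_star: "mat 1 \<le> star M" for M :: "maxplus^'n^'n"
  using mat_pow_le_star[of 0 M] by simp

lemma vec_le_star_vec: "x \<le> star M *v x" for x :: "maxplus^'n"
  using matrix_vector_mono[OF mat_1_le_star order_refl, of x M] by simp

lemma matrix_le_matrix_star: "A \<le> A ** star M" for A :: "maxplus^'n^'m"
  unfolding less_eq_vec_def
proof (intro allI)
  fix i j
  have "A $ i $ j = A $ i $ j * 1" by simp
  also have "\<dots> \<le> A $ i $ j * star M $ j $ j"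
    using mat_1_le_star[of M] by (intro mult_left_mono) (auto simp: less_eq_vec_def mat_def dest!: spec[of _ j])
  also have "\<dots> \<le> (A ** star M) $ i $ j" by (rule matrix_mult_entry_le)
  finally show "A $ i $ j \<le> (A ** star M) $ i $ j" .
qed

lemma star_vec:
  fixes M :: "maxplus^'n^'n"
  shows "star M *v x = (\<Sum>k = 0..<CARD('n). mat_pow M k *v x)"
proof -
  have "sum (mat_pow M) S *v x = (\<Sum>k\<in>S. mat_pow M k *v x)" for S
    by (induction S rule: infinite_finite_induct) (simp_all add: matrix_vector_mult_add_rdistrib)
  then show ?thesis by (simp add: star_def)
qed

lemma star_vec_le:
  fixes M :: "maxplus^'n^'n"
  shows "star M *v x \<le> y \<longleftrightarrow> (\<forall>k<CARD('n). mat_pow M k *v x \<le> y)"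
  by (auto simp: star_vec less_eq_vec_def maxplus_sum_le_iff)

text \<open>Iterating \<open>M *v x \<le> x\<close> bounds every power of \<open>M\<close> applied to \<open>x\<close>. Thus the solutions of this
  inequality are fixed by the star.\<close>

lemma star_vec_eq:
  assumes "M *v x \<le> x"
  shows "star M *v x = x"
proof (rule antisym)
  have "mat_pow M k *v x \<le> x" for k
  proof (induction k)
    case (Suc k)
    have "mat_pow M (Suc k) *v x = mat_pow M k *v (M *v x)"
      by (simp add: matrix_vector_mul_assoc)
    also have "\<dots> \<le> mat_pow M k *v x"
      using assms by (intro matrix_vector_mono) auto
    finally show ?case using Suc.IH by simp
  qed simp
  then show "star M *v x \<le> x" by (simp add: star_vec_le)
qed (rule vec_le_star_vec)

text \<open>Multiplication by \<open>M\<close> shifts the powers in the star by one. Only the last shifted power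
  is not a term of the star, and \<open>mat_pow_card_le_star\<close> absorbs it. So the star produces
  solutions of \<open>M *v x \<le> x\<close> from arbitrary vectors.\<close>

lemma matrix_star_vec_le:
  fixes M :: "maxplus^'n^'n"
  assumes "Tr M \<le> 1"
  shows "M *v (star M *v x) \<le> star M *v x"
proof -
  have pow: "mat_pow M (Suc k) *v x \<le> star M *v x" if "k < CARD('n)" for k
    using that mat_pow_card_le_star[OF assms] mat_pow_le_star[of "Suc k" M]
    by (intro matrix_vector_mono) (cases "Suc k = CARD('n)"; auto)+
  have "M *v (star M *v x) = (\<Sum>k = 0..<CARD('n). mat_pow M (Suc k) *v x)"
  proof -
    have "M *v sum f S = (\<Sum>k\<in>S. M *v f k)" for f and S :: "nat set"
      by (induction S rule: infinite_finite_induct) (simp_all add: matrix_vector_right_distrib)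
    moreover have "M ** mat_pow M k = mat_pow M (Suc k)" for k
      using mat_pow_add[of M 1 k] mat_pow_add[of M k 1] by simp
    ultimately show ?thesis by (simp add: star_vec matrix_vector_mul_assoc)
  qed
  with pow show ?thesis by (simp add: less_eq_vec_def maxplus_sum_le_iff)
qed


section \<open>The objective on the image of a matrix\<close>

text \<open>By residuation, this is the greatest vector \<open>x\<close> with \<open>P *v x \<le> d\<close> when \<open>d\<close> is regular
  and no column of \<open>P\<close> is zero. At a zero column, where \<open>x\<close> would be unbounded, the entry is \<open>0\<close> instead.\<close>

definition col_bound :: "maxplus^'m \<Rightarrow> maxplus^'n^'m \<Rightarrow> maxplus^'n" where
  "col_bound d P = conj_tr (conj_tr d v* P)"

definition optimum :: "maxplus^'m \<Rightarrow> maxplus^'n^'m \<Rightarrow> maxplus" where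
  "optimum d P = mp_pow (scalar_product (conj_tr (P *v col_bound d P)) d) (1/2)"

lemma conj_row_eq_0_iff:
  assumes "regular_vec d"
  shows "(conj_tr d v* P) $ j = 0 \<longleftrightarrow> (\<forall>i. P $ i $ j = 0)"
  using assms by (simp add: vector_matrix_mult_def regular_vec_def)

lemma le_col_bound:
  assumes "scalar_product (conj_tr d) (P *v x) \<le> t" and "(conj_tr d v* P) $ j \<noteq> 0"
  shows "x $ j \<le> t * col_bound d P $ j"
  using assms
  by (auto simp: scalar_product_matrix_vector scalar_product_le_iff col_bound_def
      simp flip: maxplus_residuation)

lemma image_cong_nonzero_columns:
  assumes "regular_vec d" and "\<And>j. (conj_tr d v* P) $ j \<noteq> 0 \<Longrightarrow> v $ j = w $ j"
  shows "P *v v = P *v w"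
proof -
  have "P $ i $ j * v $ j = P $ i $ j * w $ j" for i j
    using assms(2)[of j] conj_row_eq_0_iff[OF assms(1), of P j] by (cases "P $ i $ j = 0") (simp, metis)
  then show ?thesis by (simp add: vec_eq_iff matrix_vector_mult_def)
qed

text \<open>Where the bound \<open>le_col_bound\<close> on an entry of \<open>x\<close> is not available, the column of \<open>P\<close>
  is zero and adds nothing to the image. This is why the minimum has the
  same form whether or not a maximum solution exists.\<close>

lemma image_le_col_bound_image:
  assumes "regular_vec d" and "scalar_product (conj_tr d) (P *v x) \<le> t"
  shows "P *v x \<le> t *s (P *v col_bound d P)"
  unfolding matrix_vector_scale[symmetric] matrix_vector_le_iff
proof (intro allI)
  fix i j
  show "P $ i $ j * x $ j \<le> (P *v (t *s col_bound d P)) $ i"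
  proof (cases "P $ i $ j = 0")
    case False
    then have "x $ j \<le> (t *s col_bound d P) $ j"
      using le_col_bound[OF assms(2), of j] conj_row_eq_0_iff[OF assms(1)] by auto
    then have "P $ i $ j * x $ j \<le> P $ i $ j * (t *s col_bound d P) $ j"
      by (intro mult_left_mono) auto
    also have "\<dots> \<le> (P *v (t *s col_bound d P)) $ i" by (rule matrix_vector_entry_le)
    finally show ?thesis .
  qed simp
qed

lemma regular_col_bound_image:
  assumes "row_regular P" and "regular_vec d"
  shows "regular_vec (P *v col_bound d P)"
  unfolding regular_vec_def
proof
  fix i
  obtain j where j: "P $ i $ j \<noteq> 0" using assms(1) by (auto simp: row_regular_def)
  then have "col_bound d P $ j \<noteq> 0"
    using conj_row_eq_0_iff[OF assms(2), of P j] by (auto simp: col_bound_def)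
  with j have "P $ i $ j * col_bound d P $ j \<noteq> 0" by simp
  then show "(P *v col_bound d P) $ i \<noteq> 0"
    by (metis le_zero_eq matrix_vector_entry_le)
qed

lemma optimum_ne_0:
  assumes "row_regular P" and "regular_vec d"
  shows "optimum d P \<noteq> 0"
  using scalar_product_conj_tr_ne_0[OF regular_col_bound_image[OF assms] assms(2)]
  by (simp add: optimum_def mp_pow_eq_0_iff)

text \<open>Let \<open>t\<close> be the value of the objective. The first term of the objective being at most \<open>t\<close> gives
  \<open>P *v x \<le> t *s q\<close> with \<open>q = P *v col_bound d P\<close>. The second term is antitone in the image, so it is
  at least its value at \<open>t *s q\<close>, which is \<open>scalar_product (conj_tr q) d\<close> divided by \<open>t\<close>. The two terms pull \<open>t\<close>
  in opposite directions, and balancing them produces the square root.\<close>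

lemma optimum_le_objective:
  assumes "row_regular P" and "regular_vec d" and "regular_vec x"
  shows "optimum d P \<le> objective d (P *v x)"
proof -
  define t where "t = objective d (P *v x)"
  let ?q = "P *v col_bound d P"
  have le: "scalar_product (conj_tr d) (P *v x) \<le> t" "scalar_product (conj_tr (P *v x)) d \<le> t"
    using order_refl[of t] unfolding t_def objective_def maxplus_add_le_iff by auto
  have "regular_vec (P *v x)" using assms regular_vec_matrix_vector by blast
  then have "t \<noteq> 0" using scalar_product_conj_tr_ne_0[OF _ assms(2)] le(2) by fastforce
  have "mp_inverse t * scalar_product (conj_tr ?q) d
      = scalar_product (conj_tr (t *s ?q)) d"
    by (simp add: conj_tr_scale scalar_product_scale_left)
  also have "\<dots> \<le> scalar_product (conj_tr (P *v x)) d"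
    using assms \<open>regular_vec (P *v x)\<close> le(1)
    by (intro scalar_product_mono_left conj_tr_antimono image_le_col_bound_image)
  also have "\<dots> \<le> t" by (rule le(2))
  finally have "t * (mp_inverse t * scalar_product (conj_tr ?q) d) \<le> t * t"
    by (intro mult_left_mono) auto
  then have "scalar_product (conj_tr ?q) d \<le> t * t"
    using mult_mp_inverse[OF \<open>t \<noteq> 0\<close>] by (simp flip: mult.assoc)
  then show ?thesis unfolding t_def[symmetric] optimum_def by (rule mp_sqrt_le)
qed

text \<open>At the scale \<open>optimum d P\<close> the two terms of the objective balance: the first is at most the
  scale, the second is the square of the scale divided by the scale.\<close>

lemma objective_col_bound_image_le:
  assumes "row_regular P" and "regular_vec d"
  shows "objective d (optimum d P *s (P *v col_bound d P)) \<le> optimum d P"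
proof -
  let ?t = "optimum d P" and ?q = "P *v col_bound d P"
  have "scalar_product (conj_tr d) ?q \<le> 1"
    by (simp add: scalar_product_matrix_vector scalar_product_le_iff col_bound_def
        mult_mp_inverse_le_1)
  then have "?t * scalar_product (conj_tr d) ?q \<le> ?t * 1"
    by (intro mult_left_mono) auto
  moreover have "scalar_product (conj_tr ?q) d = ?t * ?t"
    by (simp add: optimum_def mp_sqrt_mult_self)
  then have "mp_inverse ?t * scalar_product (conj_tr ?q) d = ?t"
    using mult_mp_inverse[OF optimum_ne_0[OF assms]] by (metis mult.assoc mult.commute mult_1)
  ultimately show ?thesis
    by (simp add: objective_def maxplus_add_le_iff conj_tr_scale scalar_product_scale_left
        scalar_product_scale_right)
qed


section \<open>Solutions of the constrained problem\<close>

lemma feasible_iff: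
  "feasible A B C x y \<longleftrightarrow> regular_vec x \<and> y = A *v x \<and> (B + C ** A) *v x \<le> x"
  by (auto simp: feasible_def matrix_vector_mult_add_rdistrib matrix_vector_mul_assoc
      less_eq_vec_def maxplus_add_le_iff)

text \<open>On the feasible set \<open>A\<close> acts as \<open>A ** star (B + C ** A)\<close>, which carries the constraint on \<open>x\<close>
  over to the objective.\<close>

lemma feasible_image_star:
  assumes "feasible A B C x y"
  shows "y = (A ** star (B + C ** A)) *v x"
  using assms star_vec_eq[of "B + C ** A" x]
  by (simp add: feasible_iff flip: matrix_vector_mul_assoc)

lemma solution_objective_le:
  assumes "solution A B C d x y" and "feasible A B C x' y'"
  shows "objective d y \<le> objective d y'"
  using assms by (auto simp: solution_def is_arg_min_def not_less)

text \<open>The vector \<open>col_bound d (A ** S)\<close> itself may have entries \<open>0\<close>, at the zero columns of \<open>A ** S\<close>,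
  and then it need not lead to a regular \<open>x\<close>. Filling these entries with arbitrary finite values restores
  regularity without a change in the image \<open>y\<close>. The freedom in the choice of \<open>w\<close> also shows later that a
  maximum solution cannot exist when there is a zero column.\<close>

lemma star_scaled_solution:
  fixes A B C :: "maxplus^'n^'n" and d w :: "maxplus^'n"
  defines "S \<equiv> star (B + C ** A)"
  assumes "row_regular A" and "Tr (B + C ** A) \<le> 1" and "regular_vec d"
    and "regular_vec w"
    and w: "\<And>j. (conj_tr d v* (A ** S)) $ j \<noteq> 0 \<Longrightarrow> w $ j = col_bound d (A ** S) $ j"
  shows "solution A B C d (optimum d (A ** S) *s (S *v w))
           (optimum d (A ** S) *s ((A ** S) *v col_bound d (A ** S)))"
    and "objective d (optimum d (A ** S) *s ((A ** S) *v col_bound d (A ** S)))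
           = optimum d (A ** S)"
proof -
  let ?P = "A ** S" and ?D = "B + C ** A"
  let ?t = "optimum d ?P" and ?u = "col_bound d ?P"
  let ?x = "?t *s (S *v w)" and ?y = "?t *s (?P *v ?u)"
  have P: "row_regular ?P"
    using assms(2) matrix_le_matrix_star unfolding S_def by (rule row_regular_mono)
  have "regular_vec (S *v w)"
    using \<open>regular_vec w\<close> vec_le_star_vec unfolding S_def by (rule regular_vec_mono)
  then have "regular_vec ?x"
    using optimum_ne_0[OF P assms(4)] by (rule regular_vec_scale[rotated])
  moreover have "?y = A *v ?x"
    using image_cong_nonzero_columns[OF assms(4) w]
    by (simp add: matrix_vector_scale matrix_vector_mul_assoc)
  moreover have "?D *v ?x \<le> ?x"
    unfolding matrix_vector_scale S_def
    by (intro scale_vec_mono matrix_star_vec_le assms(3))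
  ultimately have feas: "feasible A B C ?x ?y" by (simp add: feasible_iff)
  have bound: "?t \<le> objective d y" if "feasible A B C x y" for x y
    using optimum_le_objective[OF P assms(4), of x] that feasible_image_star[OF that]
    by (simp add: feasible_iff S_def)
  show obj: "objective d ?y = ?t"
    using objective_col_bound_image_le[OF P assms(4)] bound[OF feas] by (rule antisym)
  show "solution A B C d ?x ?y"
    using feas bound by (auto simp: solution_def is_arg_min_def obj not_less)
qed

theorem theorem7:
  fixes A B C D :: "maxplus^'n^'n" and d :: "maxplus^'n"
  assumes "row_regular A"
    and "D = B + C ** A"
    and "Tr D \<le> 1"
    and "regular_vec d"
  shows "let u = conj_tr (conj_tr d v* (A ** star D));
             \<Delta> = mp_pow (scalar_product (conj_tr ((A ** star D) *v u)) d) (1/2);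
             X = \<Delta> *s (star D *v u);
             Y = \<Delta> *s ((A ** star D) *v u)
         in minimum_value A B C d \<Delta>
          \<and> (\<forall>x y. maximum_solution A B C d x y \<longrightarrow> x = X \<and> y = Y)
          \<and> (regular_vec (conj_tr d v* (A ** star D)) \<longrightarrow> maximum_solution A B C d X Y)"
proof -
  define P where "P = A ** star D"
  define r where "r = conj_tr d v* P"
  define u where "u = col_bound d P"
  define t where "t = optimum d P"
  let ?X = "t *s (star D *v u)" and ?Y = "t *s (P *v u)"
  \<comment> \<open>When no column of \<open>P\<close> is zero, \<open>fill c\<close> is just \<open>u\<close>.\<close>
  define fill where "fill c = (\<chi> j. if r $ j = 0 then c else u $ j)" for c
  have "t \<noteq> 0"
    unfolding t_def P_def
    using row_regular_mono[OF assms(1) matrix_le_matrix_star] assms(4) by (rule optimum_ne_0)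
  have fill: "solution A B C d (t *s (star D *v fill c)) ?Y" "objective d ?Y = t"
    if "c \<noteq> 0" for c
  proof -
    let ?P = "A ** star (B + C ** A)"
    have "Tr (B + C ** A) \<le> 1"
      using assms(2,3) by simp
    moreover have "regular_vec (fill c)"
      using that by (auto simp: regular_vec_def fill_def u_def col_bound_def r_def)
    moreover have "fill c $ j = col_bound d ?P $ j" if "(conj_tr d v* ?P) $ j \<noteq> 0" for j
      using that by (simp add: fill_def r_def u_def P_def assms(2))
    ultimately show "solution A B C d (t *s (star D *v fill c)) ?Y" "objective d ?Y = t"
      unfolding t_def u_def P_def assms(2)
      using star_scaled_solution[OF assms(1) _ assms(4), of B C "fill c"] by blast+
  qed
  have min: "minimum_value A B C d t"
    using fill[of 1] by (auto simp: minimum_value_def)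
  have max: "maximum_solution A B C d ?X ?Y" if "regular_vec r"
    unfolding maximum_solution_def
  proof (intro conjI allI impI)
    have "fill 1 = u" using that by (simp add: fill_def regular_vec_def vec_eq_iff)
    then show sol: "solution A B C d ?X ?Y" using fill(1)[of 1] by simp
    fix x y
    assume xy: "solution A B C d x y"
    have feas: "feasible A B C x y"
      using xy by (simp add: solution_def is_arg_min_def)
    have "objective d y \<le> t"
      using solution_objective_le[OF xy, of ?X ?Y] sol fill(2)[of 1]
      by (simp add: solution_def is_arg_min_def)
    then have dy: "scalar_product (conj_tr d) (P *v x) \<le> t"
      using feasible_image_star[OF feas] by (simp add: objective_def maxplus_add_le_iff P_def assms(2))
    have "x \<le> t *s u"
      using le_col_bound[OF dy] that by (simp add: less_eq_vec_def regular_vec_def r_def u_def)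
    then have "star D *v x \<le> ?X"
      unfolding matrix_vector_scale[symmetric] by (intro matrix_vector_mono) auto
    moreover have "star D *v x = x"
      using feas by (intro star_vec_eq) (simp add: feasible_iff assms(2))
    ultimately show "x \<le> ?X" by simp
    show "y \<le> ?Y"
      using image_le_col_bound_image[OF assms(4) dy] feasible_image_star[OF feas]
      by (simp add: P_def u_def assms(2))
  qed
  have uniq: "x = ?X \<and> y = ?Y" if xy: "maximum_solution A B C d x y" for x y
  proof (cases "regular_vec r")
    case True
    then show ?thesis
      using max[OF True] xy unfolding maximum_solution_def by (meson antisym)
  next
    case False
    then obtain j where j: "r $ j = 0" by (auto simp: regular_vec_def)
    have "x $ j \<noteq> 0"
      using xy by (auto simp: maximum_solution_def solution_def is_arg_min_def feasible_def regular_vec_def)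
    \<comment> \<open>The filling value that makes entry \<open>j\<close> of the resulting solution exceed \<open>x $ j\<close> by at
      least the real number one, which contradicts the maximality of \<open>x\<close>.\<close>
    define c where "c = mp_inverse t * (x $ j * Fin 1)"
    have "Fin 1 \<noteq> 0" by (simp add: zero_maxplus_def)
    then have "c \<noteq> 0" using \<open>t \<noteq> 0\<close> \<open>x $ j \<noteq> 0\<close> by (simp add: c_def)
    have "x $ j * Fin 1 = t * fill c $ j"
      using mult_mp_inverse[OF \<open>t \<noteq> 0\<close>] j by (simp add: fill_def c_def flip: mult.assoc)
    also have "\<dots> \<le> t * (star D *v fill c) $ j"
      using vec_le_star_vec[of "fill c" D] by (intro mult_left_mono) (auto simp: less_eq_vec_def)
    also have "\<dots> = (t *s (star D *v fill c)) $ j" by simp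
    also have "\<dots> \<le> x $ j"
      using xy fill(1)[OF \<open>c \<noteq> 0\<close>] unfolding maximum_solution_def less_eq_vec_def by blast
    finally show ?thesis
      using \<open>x $ j \<noteq> 0\<close> by (cases "x $ j") (auto simp: zero_maxplus_def)
  qed
  show ?thesis
    unfolding Let_def
    using min max uniq
    by (simp add: t_def u_def optimum_def r_def P_def col_bound_def)
qed

end
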